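(* Let $(\mathfrak{A},\mathsf{L}_{\mathfrak{A}})$ and $(\mathfrak{B},\mathsf{L}_{\mathfrak{B}})$ be two quantum compact metric spaces whose Lip-norms are lower semi-continuous on, respectively, $\mathfrak{sa}(\mathfrak{A})$ and $\mathfrak{sa}(\mathfrak{B})$. Let $\varphi:\mathfrak{A}\to\mathfrak{B}$ be a unital *-morphism such that $\varphi(\mathrm{dom}(\mathsf{L}_{\mathfrak{A}}))\subseteq\mathrm{dom}(\mathsf{L}_{\mathfrak{B}})$. Then there exists $C>0$ such that $\mathsf{L}_{\mathfrak{B}}\circ\varphi\leq C\,\mathsf{L}_{\mathfrak{A}}$, i.e. $\varphi$ is a $C$-Lipschitz morphism.
   Context: For a unital C*-algebra $\mathfrak{A}$ with unit $1_{\mathfrak{A}}$, $\mathfrak{sa}(\mathfrak{A})$ is the space of self-adjoint elements and $\mathscr{S}(\mathfrak{A})$ the state space. A quantum compact metric space $(\mathfrak{A},\mathsf{L})$ is a unital C*-algebra $\mathfrak{A}$ with a seminorm $\mathsf{L}$ (called a Lip-norm) defined on a dense subspace $\mathrm{dom}(\mathsf{L})$ of $\mathfrak{sa}(\mathfrak{A})$ such that $\{a\in\mathrm{dom}(\mathsf{L}):\mathsf{L}(a)=0\}=\mathbb{R}1_{\mathfrak{A}}$ and the Monge-Kantorovich metric $\mathsf{mk}_{\mathsf{L}}(\varphi,\psi)=\sup\{|\varphi(a)-\psi(a)| : a\in\mathrm{dom}(\mathsf{L}),\ \mathsf{L}(a)\leq 1\}$ metrizes the weak* topology on $\mathscr{S}(\mathfrak{A})$.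 A Lip-norm takes the value $\infty$ outside its domain. $\mathsf{L}$ is lower semi-continuous on $\mathfrak{sa}(\mathfrak{A})$ when $\{a\in\mathrm{dom}(\mathsf{L}):\mathsf{L}(a)\leq 1\}$ is norm closed in $\mathfrak{sa}(\mathfrak{A})$. A unital *-morphism $\varphi:\mathfrak{A}\to\mathfrak{B}$ is $C$-Lipschitz when $\mathsf{L}_{\mathfrak{B}}(\varphi(a))\leq C\,\mathsf{L}_{\mathfrak{A}}(a)$ for all $a\in\mathfrak{sa}(\mathfrak{A})$. *)

theory Defs
  imports "HOL-Analysis.Analysis"
begin

section \<open>Unital C*-algebras\<close>

(* The real scalar multiplication inherited from the library is the restriction of scaleC.
   The unit comes from monoid_mult rather than from real_normed_algebra_1 because the latter
   imposes 0 \<noteq> 1, which would exclude the zero algebra. *)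
class unital_cstar_algebra = real_normed_algebra + monoid_mult + banach +
  fixes scaleC :: "complex \<Rightarrow> 'a \<Rightarrow> 'a"
    and star :: "'a \<Rightarrow> 'a"
  assumes scaleC_of_real: "scaleC (complex_of_real r) x = r *\<^sub>R x"
    and scaleC_add_right: "scaleC z (x + y) = scaleC z x + scaleC z y"
    and scaleC_add_left: "scaleC (z + w) x = scaleC z x + scaleC w x"
    and scaleC_scaleC: "scaleC z (scaleC w x) = scaleC (z * w) x"
    and scaleC_mult_left: "scaleC z x * y = scaleC z (x * y)"
    and scaleC_mult_right: "x * scaleC z y = scaleC z (x * y)"
    and norm_scaleC: "norm (scaleC z x) = cmod z * norm x"
    and star_star: "star (star x) = x"
    and star_add: "star (x + y) = star x + star y"
    and star_scaleC: "star (scaleC z x) = scaleC (cnj z) (star x)"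
    and star_mult: "star (x * y) = star y * star x"
    and cstar_identity: "norm (star x * x) = (norm x)\<^sup>2"

definition self_adjoint :: "'a::unital_cstar_algebra set" where
  "self_adjoint = {a. star a = a}"

definition unital_star_morphism ::
  "('a::unital_cstar_algebra \<Rightarrow> 'b::unital_cstar_algebra) \<Rightarrow> bool" where
  "unital_star_morphism \<phi> \<longleftrightarrow>
     (\<forall>x y. \<phi> (x + y) = \<phi> x + \<phi> y) \<and>
     (\<forall>z x. \<phi> (scaleC z x) = scaleC z (\<phi> x)) \<and>
     (\<forall>x y. \<phi> (x * y) = \<phi> x * \<phi> y) \<and>
     (\<forall>x. \<phi> (star x) = star (\<phi> x)) \<and>
     \<phi> 1 = 1"

section \<open>The state space and its weak* topology\<close>

definition state_space :: "('a::unital_cstar_algebra \<Rightarrow> complex) set" where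
  "state_space = {\<mu>.
     (\<forall>x y. \<mu> (x + y) = \<mu> x + \<mu> y) \<and>
     (\<forall>z x. \<mu> (scaleC z x) = z * \<mu> x) \<and>
     (\<forall>x. \<mu> (star x * x) \<in> \<real>\<^sub>\<ge>\<^sub>0) \<and>
     \<mu> 1 = 1}"

(* The weak* topology is the topology of pointwise convergence, i.e. the trace on the state
   space of the product topology on the space of all functions. *)
definition weak_star_topology :: "('a::unital_cstar_algebra \<Rightarrow> complex) topology" where
  "weak_star_topology =
     subtopology (product_topology (\<lambda>_. euclidean) UNIV) state_space"

section \<open>Quantum compact metric spaces\<close>

(* A Lip-norm is a function that takes the value \<infinity> outside its domain. As it lives on the
   self-adjoint part only, its values at other elements are arbitrary and never used. *)
definition Lip_dom :: "('a::unital_cstar_algebra \<Rightarrow> ennreal) \<Rightarrow> 'a set" where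
  "Lip_dom L = {a \<in> self_adjoint. L a < \<infinity>}"

definition mk_dist ::
  "('a::unital_cstar_algebra \<Rightarrow> ennreal) \<Rightarrow> ('a \<Rightarrow> complex) \<Rightarrow> ('a \<Rightarrow> complex) \<Rightarrow> ennreal" where
  "mk_dist L \<mu> \<nu> = (SUP a \<in> {a \<in> Lip_dom L. L a \<le> 1}. ennreal (cmod (\<mu> a - \<nu> a)))"

(* The supremum above may a priori be infinite; being a metric includes finiteness, which
   is also what makes the conversion to real numbers meaningful. *)
definition metrizes :: "('s \<Rightarrow> 's \<Rightarrow> ennreal) \<Rightarrow> 's topology \<Rightarrow> bool" where
  "metrizes d X \<longleftrightarrow>
     (\<forall>x \<in> topspace X. \<forall>y \<in> topspace X. d x y < \<infinity>) \<and>
     Metric_space (topspace X) (\<lambda>x y. enn2real (d x y)) \<and>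
     Metric_space.mtopology (topspace X) (\<lambda>x y. enn2real (d x y)) = X"

definition quantum_compact_metric_space ::
  "('a::unital_cstar_algebra \<Rightarrow> ennreal) \<Rightarrow> bool" where
  "quantum_compact_metric_space L \<longleftrightarrow>
     subspace (Lip_dom L) \<and>
     self_adjoint \<subseteq> closure (Lip_dom L) \<and>
     (\<forall>a \<in> Lip_dom L. \<forall>b \<in> Lip_dom L. L (a + b) \<le> L a + L b) \<and>
     (\<forall>a \<in> Lip_dom L. \<forall>t::real. L (t *\<^sub>R a) = ennreal \<bar>t\<bar> * L a) \<and>
     {a \<in> Lip_dom L. L a = 0} = range (\<lambda>t::real. t *\<^sub>R 1) \<and>
     metrizes (mk_dist L) weak_star_topology"

definition lower_semicontinuous_Lip :: "('a::unital_cstar_algebra \<Rightarrow> ennreal) \<Rightarrow> bool" where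
  "lower_semicontinuous_Lip L \<longleftrightarrow>
     closedin (top_of_set self_adjoint) {a \<in> Lip_dom L. L a \<le> 1}"

definition Lipschitz_morphism ::
  "real \<Rightarrow> ('a::unital_cstar_algebra \<Rightarrow> ennreal) \<Rightarrow> ('b::unital_cstar_algebra \<Rightarrow> ennreal)
     \<Rightarrow> ('a \<Rightarrow> 'b) \<Rightarrow> bool" where
  "Lipschitz_morphism C L\<^sub>A L\<^sub>B \<phi> \<longleftrightarrow>
     unital_star_morphism \<phi> \<and> (\<forall>a \<in> self_adjoint. L\<^sub>B (\<phi> a) \<le> ennreal C * L\<^sub>A a)"

end

theory Submission
  imports Defs
begin

text \<open>States contract self-adjoint elements and one of them attains the norm. The state space is
  weak* compact, hence of finite diameter for the Monge--Kantorovich metric, so modulo constants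
  the Lip-unit ball of the domain algebra lies in some norm ball of radius \<open>D\<close>. Its part
  \<open>K\<close> in that ball is closed, convex and bounded, and is the countable union of the sets
  \<open>{a \<in> K. L\<^sub>B (\<phi> a) \<le> m}\<close>, which are closed by lower semi-continuity and continuity of \<open>\<phi>\<close>. By
  Baire one of them contains \<open>(1 - \<delta>) a + \<delta> K\<close> for some \<open>a\<close> and \<open>\<delta> > 0\<close>; since
  \<open>L\<^sub>B\<close> is a seminorm, \<open>L\<^sub>B \<circ> \<phi>\<close> is then bounded on \<open>K\<close>.

  No spectral theory is needed for this: square roots come from the
  iteration \<open>y \<mapsto> (b + y\<^sup>2) / 2\<close>.\<close>

section \<open>Sublinear functionals and the Hahn--Banach theorem\<close>

definition sublinear :: "('v::real_vector \<Rightarrow> real) \<Rightarrow> bool" where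
  "sublinear p \<longleftrightarrow>
     (\<forall>x y. p (x + y) \<le> p x + p y) \<and> (\<forall>t x. 0 \<le> t \<longrightarrow> p (t *\<^sub>R x) = t * p x)"

lemma sublinear_add: "sublinear p \<Longrightarrow> p (x + y) \<le> p x + p y"
  by (simp add: sublinear_def)

lemma sublinear_scaleR: "sublinear p \<Longrightarrow> 0 \<le> t \<Longrightarrow> p (t *\<^sub>R x) = t * p x"
  by (simp add: sublinear_def)

lemma sublinear_zero: "sublinear p \<Longrightarrow> p 0 = 0"
  using sublinear_scaleR[of p 0 0] by simp

lemma sublinear_ge_minus: "sublinear p \<Longrightarrow> - p (- x) \<le> p x"
  using sublinear_add[of p x "- x"] sublinear_zero[of p] by simp

text \<open>The bound at \<open>inverse t\<close> supplies the reverse inequality at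
  \<open>t\<close>, and the factors 2 and 1/2 force \<open>p 0 = 0\<close>.\<close>

lemma sublinearI:
  assumes add: "\<And>x y. p (x + y) \<le> p x + p y"
    and scale: "\<And>t x. 0 < t \<Longrightarrow> p (t *\<^sub>R x) \<le> t * p x"
  shows "sublinear p"
proof -
  have "p 0 = 0"
    using scale[of 2 0] scale[of "1/2" 0] by simp
  moreover have "p (t *\<^sub>R x) = t * p x" if "0 < t" for t x
  proof (rule antisym)
    have "p x \<le> inverse t * p (t *\<^sub>R x)"
      using scale[of "inverse t" "t *\<^sub>R x"] that by simp
    then show "t * p x \<le> p (t *\<^sub>R x)"
      using that by (simp add: field_simps)
  qed (simp add: scale that)
  ultimately show ?thesis
    unfolding sublinear_def using add
    by (metis mult_zero_left order_le_less scaleR_zero_left)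
qed

text \<open>For sublinear \<open>p\<close> this is the largest sublinear \<open>q \<le> p\<close>
  with \<open>q (- x) \<le> - p x\<close>, so a linear functional below it takes exactly the value
  \<open>p x\<close> at \<open>x\<close>.\<close>

definition shift :: "('v::real_vector \<Rightarrow> real) \<Rightarrow> 'v \<Rightarrow> 'v \<Rightarrow> real" where
  "shift p x y = (INF t\<in>{0..}. p (y + t *\<^sub>R x) - t * p x)"

lemma shift_bdd_below:
  assumes "sublinear p"
  shows "bdd_below ((\<lambda>t. p (y + t *\<^sub>R x) - t * p x) ` {0..})"
proof (rule bdd_belowI2)
  fix t :: real assume "t \<in> {0..}"
  then have "t * p x \<le> p (y + t *\<^sub>R x) + p (- y)"
    using sublinear_add[OF assms, of "y + t *\<^sub>R x" "- y"] sublinear_scaleR[OF assms, of t x]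
    by simp
  then show "- p (- y) \<le> p (y + t *\<^sub>R x) - t * p x" by simp
qed

lemma shift_le:
  assumes "sublinear p" "0 \<le> t"
  shows "shift p x y \<le> p (y + t *\<^sub>R x) - t * p x"
  unfolding shift_def using assms by (intro cINF_lower shift_bdd_below) auto

lemma shift_greatest:
  assumes "\<And>t. 0 \<le> t \<Longrightarrow> c \<le> p (y + t *\<^sub>R x) - t * p x"
  shows "c \<le> shift p x y"
  unfolding shift_def using assms by (intro cINF_greatest) auto

lemma shift_le_self: "sublinear p \<Longrightarrow> shift p x y \<le> p y"
  using shift_le[of p 0 x y] by simp

lemma shift_uminus_le: "sublinear p \<Longrightarrow> shift p x (- x) \<le> - p x"
  using shift_le[of p 1 x "- x"] sublinear_zero[of p] by simp

text \<open>Parameters \<open>s\<close> and \<open>t\<close> for the two summands merge into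
  \<open>s + t\<close>, and the infima are then taken one at a time. For homogeneity the parameter
  \<open>t\<close> is rescaled to \<open>c * t\<close>.\<close>

lemma sublinear_shift:
  assumes p: "sublinear p"
  shows "sublinear (shift p x)"
proof (rule sublinearI)
  fix y z
  have "shift p x (y + z) - (p (y + s *\<^sub>R x) - s * p x) \<le> p (z + t *\<^sub>R x) - t * p x"
    if "0 \<le> s" "0 \<le> t" for s t
    using shift_le[OF p, of "s + t" x "y + z"] that
      sublinear_add[OF p, of "y + s *\<^sub>R x" "z + t *\<^sub>R x"]
    by (simp add: algebra_simps)
  then have "shift p x (y + z) - (p (y + s *\<^sub>R x) - s * p x) \<le> shift p x z" if "0 \<le> s" for s
    using that by (intro shift_greatest) auto
  then have "shift p x (y + z) - shift p x z \<le> shift p x y"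
    by (intro shift_greatest) (smt (verit))
  then show "shift p x (y + z) \<le> shift p x y + shift p x z" by simp
next
  fix c :: real and y assume c: "0 < c"
  have "inverse c * shift p x (c *\<^sub>R y) \<le> p (y + t *\<^sub>R x) - t * p x" if "0 \<le> t" for t
  proof -
    have "shift p x (c *\<^sub>R y) \<le> p (c *\<^sub>R y + (c * t) *\<^sub>R x) - c * t * p x"
      using shift_le[OF p, of "c * t"] that c by simp
    also have "p (c *\<^sub>R y + (c * t) *\<^sub>R x) = c * p (y + t *\<^sub>R x)"
      using sublinear_scaleR[OF p, of c "y + t *\<^sub>R x"] c by (simp add: scaleR_add_right)
    finally show ?thesis using c by (simp add: field_simps)
  qed
  then have "inverse c * shift p x (c *\<^sub>R y) \<le> shift p x y"
    by (rule shift_greatest)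
  then show "shift p x (c *\<^sub>R y) \<le> c * shift p x y"
    using c by (simp add: field_simps)
qed

text \<open>Zorn's lemma gives a minimal sublinear functional below \<open>p\<close>. It coincides
  with each of its shifts, and this makes it additive.\<close>

lemma Hahn_Banach_sublinear:
  fixes p :: "'v::real_vector \<Rightarrow> real"
  assumes p: "sublinear p"
  obtains f where "linear f" "\<And>x. f x \<le> p x"
proof -
  define S where "S = {q. sublinear q \<and> (\<forall>x. q x \<le> p x)}"
  \<comment> \<open>The order is reversed, so a maximal element for \<open>R\<close> is a minimal
    functional.\<close>
  define R where "R = (\<lambda>q r :: 'v \<Rightarrow> real. r \<le> q)"
  have "\<exists>m\<in>S. \<forall>q\<in>S. R m q \<longrightarrow> q = m"
  proof (rule predicate_Zorn)
    show "partial_order_on S (relation_of R S)"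
      by (rule partial_order_on_relation_ofI) (auto simp: R_def)
    fix C assume C: "C \<in> Chains (relation_of R S)"
    then have CS: "C \<subseteq> S" and tot: "\<And>q r. q \<in> C \<Longrightarrow> r \<in> C \<Longrightarrow> q \<le> r \<or> r \<le> q"
      by (auto simp: Chains_def relation_of_def R_def)
    show "\<exists>u\<in>S. \<forall>q\<in>C. R q u"
    proof (cases "C = {}")
      case True
      then show ?thesis using p by (auto simp: S_def)
    next
      case False
      \<comment> \<open>The pointwise infimum of the chain is finite because every member at
        \<open>x\<close> is at least \<open>- p (- x)\<close>.\<close>
      define u where "u x = (INF q\<in>C. q x)" for x
      have bdd: "bdd_below ((\<lambda>q. q x) ` C)" for x
      proof (rule bdd_belowI2)
        fix q assume "q \<in> C"
        with CS have "sublinear q" "q (- x) \<le> p (- x)" by (auto simp: S_def)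
        with sublinear_ge_minus[of q x] show "- p (- x) \<le> q x" by simp
      qed
      have low: "u x \<le> q x" if "q \<in> C" for q x
        unfolding u_def using bdd that by (rule cINF_lower)
      have great: "c \<le> u x" if "\<And>q. q \<in> C \<Longrightarrow> c \<le> q x" for c x
        unfolding u_def using False that by (rule cINF_greatest)
      have "sublinear u"
      proof (rule sublinearI)
        fix x y
        have "u (x + y) - q x \<le> r y" if "q \<in> C" "r \<in> C" for q r
        proof -
          \<comment> \<open>The smaller of two chain members serves for both, which makes the
            infimum subadditive.\<close>
          have "\<exists>s\<in>C. s \<le> q \<and> s \<le> r"
            using tot[OF that] that by auto
          then obtain s where s: "s \<in> C" "s \<le> q" "s \<le> r" by blast
          then have "u (x + y) \<le> s x + s y"
            using low[of s "x + y"] CS sublinear_add[of s x y] by (force simp: S_def)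
          also have "\<dots> \<le> q x + r y"
            using s by (intro add_mono) (auto simp: le_fun_def)
          finally show ?thesis by simp
        qed
        then have "u (x + y) - q x \<le> u y" if "q \<in> C" for q
          using that by (intro great) auto
        then have "u (x + y) - u y \<le> u x"
          by (intro great) (smt (verit))
        then show "u (x + y) \<le> u x + u y" by simp
      next
        fix t :: real and x assume t: "0 < t"
        have "inverse t * u (t *\<^sub>R x) \<le> q x" if "q \<in> C" for q
        proof -
          have "q (t *\<^sub>R x) = t * q x"
            using that CS t by (intro sublinear_scaleR) (auto simp: S_def)
          with low[OF that, of "t *\<^sub>R x"] t show ?thesis by (simp add: field_simps)
        qed
        then have "inverse t * u (t *\<^sub>R x) \<le> u x" by (rule great)
        then show "u (t *\<^sub>R x) \<le> t * u x" using t by (simp add: field_simps)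
      qed
      moreover have "u x \<le> p x" for x
        using False low CS by (force simp: S_def intro: order_trans)
      ultimately show ?thesis
        using low by (auto simp: S_def R_def le_fun_def)
    qed
  qed
  then obtain q where "q \<in> S" and max: "\<And>r. r \<in> S \<Longrightarrow> R q r \<Longrightarrow> r = q"
    by blast
  then have q: "sublinear q" "\<And>x. q x \<le> p x"
    by (auto simp: S_def)
  have min: "r = q" if "sublinear r" "\<And>x. r x \<le> q x" for r
    using that q(2) by (intro max) (auto simp: S_def R_def le_fun_def intro: order_trans)
  have shift_q: "shift q x = q" for x
    by (intro min sublinear_shift shift_le_self q)
  \<comment> \<open>The parameter 1 in \<open>shift q y x = q x\<close> gives
    \<open>q x \<le> q (x + y) - q y\<close>.\<close>
  have add: "q (x + y) = q x + q y" for x y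
    using shift_le[OF q(1), of 1 y x] sublinear_add[OF q(1), of x y] shift_q[of y] by simp
  have neg: "q (- x) = - q x" for x
    using add[of x "- x"] sublinear_zero[OF q(1)] by simp
  have "linear q"
  proof (rule linearI)
    fix t x
    show "q (t *\<^sub>R x) = t *\<^sub>R q x"
      using sublinear_scaleR[OF q(1), of t x] sublinear_scaleR[OF q(1), of "- t" x] neg[of "t *\<^sub>R x"]
      by (cases "0 \<le> t") auto
  qed (rule add)
  with q(2) show thesis using that by blast
qed

section \<open>Positive elements of a C*-algebra\<close>

lemma star_scaleR: "star (r *\<^sub>R x) = r *\<^sub>R star (x::'a::unital_cstar_algebra)"
  by (metis complex_cnj_complex_of_real scaleC_of_real star_scaleC)

lemma linear_star: "linear (star :: 'a::unital_cstar_algebra \<Rightarrow> 'a)"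
  by (rule linearI) (simp_all add: star_add star_scaleR)

lemmas star_zero = linear_0[OF linear_star]
  and star_minus = linear_neg[OF linear_star]
  and star_diff = linear_diff[OF linear_star]

lemma star_one: "star 1 = (1::'a::unital_cstar_algebra)"
  by (metis mult_1_right mult_1_left star_mult star_star)

lemma norm_star: "norm (star x) = norm (x::'a::unital_cstar_algebra)"
proof -
  have "norm y \<le> norm (star y)" for y :: 'a
    using cstar_identity[of y] norm_mult_ineq[of "star y" y]
    by (cases "norm y = 0") (auto simp: power2_eq_square)
  from this[of x] this[of "star x"] show ?thesis by (simp add: star_star)
qed

lemma norm_square: "star q = q \<Longrightarrow> norm (q * q) = (norm (q::'a::unital_cstar_algebra))\<^sup>2"
  using cstar_identity[of q] by simp

lemma square_eq_0: "star q = q \<Longrightarrow> q * q = 0 \<Longrightarrow> q = (0::'a::unital_cstar_algebra)"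
  using norm_square[of q] by simp

text \<open>Only an inequality, since the unit of the zero algebra has norm 0.\<close>

lemma norm_one_le: "norm (1::'a::unital_cstar_algebra) \<le> 1"
  using norm_square[of "1::'a"] star_one[where 'a = 'a] by (cases "norm (1::'a) = 0") (auto simp: power2_eq_square)

lemma bounded_linear_star: "bounded_linear (star :: 'a::unital_cstar_algebra \<Rightarrow> 'a)"
  by (rule bounded_linear_intro[where K = 1]) (simp_all add: star_add star_scaleR norm_star)

lemma scaleC_minus_one: "scaleC (- 1) x = - (x::'a::unital_cstar_algebra)"
  using scaleC_of_real[of "- 1" x] by simp

lemma scaleC_ii_mult: "scaleC \<i> x * scaleC \<i> y = - (x * y :: 'a::unital_cstar_algebra)"
  by (simp add: scaleC_mult_left scaleC_mult_right scaleC_scaleC scaleC_minus_one)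

lemma linear_scaleC: "linear (scaleC z :: 'a::unital_cstar_algebra \<Rightarrow> 'a)"
proof (rule linearI)
  fix r and x :: 'a
  show "scaleC z (r *\<^sub>R x) = r *\<^sub>R scaleC z x"
    by (simp flip: scaleC_of_real add: scaleC_scaleC mult.commute)
qed (rule scaleC_add_right)

lemmas scaleC_diff_right = linear_diff[OF linear_scaleC]

lemma star_scaleC_ii: "star (scaleC \<i> x) = - scaleC \<i> (star (x::'a::unital_cstar_algebra))"
proof -
  have "scaleC (- \<i>) (star x) = scaleC (- 1) (scaleC \<i> (star x))"
    by (simp add: scaleC_scaleC)
  then show ?thesis by (simp add: star_scaleC scaleC_minus_one)
qed

text \<open>With \<open>u = h + i k\<close> one has \<open>star u * u = h * h + k * k\<close>, and \<open>h\<close> is the real part of \<open>u\<close>.\<close>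

lemma norm_le_sum_squares:
  fixes h k :: "'a::unital_cstar_algebra"
  assumes h: "star h = h" and k: "star k = k" and comm: "h * k = k * h"
  shows "(norm h)\<^sup>2 \<le> norm (h * h + k * k)"
proof -
  define u where "u = h + scaleC \<i> k"
  have su: "star u = h - scaleC \<i> k"
    by (simp add: u_def star_add star_scaleC_ii h k)
  have "star u * u = h * h + k * k"
    unfolding su
    by (unfold u_def, simp add: algebra_simps scaleC_ii_mult) (simp add: scaleC_mult_left scaleC_mult_right comm)
  then have "norm (h * h + k * k) = (norm u)\<^sup>2"
    using cstar_identity[of u] by simp
  moreover have "h = (1/2) *\<^sub>R (u + star u)"
    unfolding su by (simp add: u_def flip: scaleR_2)
  then have "norm h \<le> norm u"
    using norm_triangle_ineq[of u "star u"] by (simp add: norm_star)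
  ultimately show ?thesis by (simp add: power_mono)
qed

text \<open>A fixed point of the iteration satisfies \<open>2 y = b + y * y\<close>, that is,
  \<open>1 - y\<close> is a square root of \<open>1 - b\<close>. The iterates are polynomials in
  \<open>b\<close>, whence the commutation clause.\<close>

lemma sqrt_one_minus_exists:
  fixes b :: "'a::unital_cstar_algebra"
  assumes b: "star b = b" "norm b \<le> 1"
  obtains y where "star y = y" "norm y \<le> 1" "(1 - y) * (1 - y) = 1 - b"
    "\<And>z. z * b = b * z \<Longrightarrow> z * y = y * z"
proof -
  define y where "y = rec_nat 0 (\<lambda>_ v. (1/2) *\<^sub>R (b + v * v))"
  \<comment> \<open>The same iteration for the scalar 1 is a majorant: it is increasing and bounded
    by 1, and its increments dominate those of \<open>y\<close>.\<close>
  define r where "r = rec_nat 0 (\<lambda>_ v. (1 + v * v) / 2 :: real)"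
  have y0: "y 0 = 0" and ySuc: "\<And>n. y (Suc n) = (1/2) *\<^sub>R (b + y n * y n)"
    by (simp_all add: y_def)
  have r0: "r 0 = 0" and rSuc: "\<And>n. r (Suc n) = (1 + r n * r n) / 2"
    by (simp_all add: r_def)
  have r: "0 \<le> r n \<and> r n \<le> 1" for n
    by (induction n) (auto simp: r0 rSuc mult_le_one)
  have r_step: "r n \<le> r (Suc n)" for n
    using zero_le_square[of "1 - r n"] by (simp add: rSuc algebra_simps)
  have comm: "z * y n = y n * z" if "z * b = b * z" for z n
  proof (induction n)
    case (Suc n)
    have "z * (y n * y n) = y n * y n * z"
      by (metis Suc mult.assoc)
    then show ?case by (simp add: ySuc algebra_simps that)
  qed (simp add: y0)
  have comm_y: "y m * y n = y n * y m" for m n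
    using comm[of b] comm[of "y m" n] by simp
  have y_le: "norm (y n) \<le> r n" for n
  proof (induction n)
    case (Suc n)
    have "norm (y n * y n) \<le> r n * r n"
      using Suc r[of n] by (intro order_trans[OF norm_mult_ineq] mult_mono) auto
    then show ?case
      using norm_triangle_ineq[of b "y n * y n"] b by (simp add: ySuc rSuc)
  qed (simp add: y0 r0)
  have step: "norm (y (Suc n) - y n) \<le> r (Suc n) - r n" for n
  proof (induction n)
    case 0
    then show ?case using b by (simp add: y0 r0 ySuc rSuc)
  next
    case (Suc n)
    \<comment> \<open>The difference of two squares factors because the iterates commute.\<close>
    have "y (Suc (Suc n)) - y (Suc n) = (1/2) *\<^sub>R ((y (Suc n) - y n) * (y (Suc n) + y n))"
      unfolding ySuc[of "Suc n"] using comm_y[of "Suc n" n]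
      by (subst (3) ySuc) (simp add: algebra_simps)
    also have "norm \<dots> \<le> (1/2) * ((r (Suc n) - r n) * (r (Suc n) + r n))"
    proof -
      have "norm (y (Suc n) + y n) \<le> r (Suc n) + r n"
        by (intro norm_triangle_mono y_le)
      then have "norm ((y (Suc n) - y n) * (y (Suc n) + y n)) \<le> (r (Suc n) - r n) * (r (Suc n) + r n)"
        using Suc r_step[of n] by (intro order_trans[OF norm_mult_ineq] mult_mono) auto
      then show ?thesis by simp
    qed
    also have "\<dots> = r (Suc (Suc n)) - r (Suc n)"
      unfolding rSuc[of "Suc n"] by (subst (5) rSuc) (simp add: algebra_simps)
    finally show ?case .
  qed
  have dist_le: "norm (y (m + k) - y m) \<le> r (m + k) - r m" for m k
  proof (induction k)
    case (Suc k)
    have "y (m + Suc k) - y m = (y (Suc (m + k)) - y (m + k)) + (y (m + k) - y m)" by simp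
    also have "norm \<dots> \<le> (r (Suc (m + k)) - r (m + k)) + (r (m + k) - r m)"
      by (intro norm_triangle_mono step Suc)
    finally show ?case by simp
  qed simp
  have "incseq r" using r_step by (rule incseq_SucI)
  then have "Cauchy r"
    using r by (intro LIMSEQ_imp_Cauchy[OF LIMSEQ_incseq_SUP]) (auto intro!: bdd_aboveI2[of _ _ 1])
  have "Cauchy y"
  proof (rule metric_CauchyI)
    fix e :: real assume "0 < e"
    then obtain M where M: "\<And>m n. M \<le> m \<Longrightarrow> M \<le> n \<Longrightarrow> dist (r m) (r n) < e"
      using metric_CauchyD[OF \<open>Cauchy r\<close>] by blast
    have ord: "dist (y m) (y n) < e" if "M \<le> m" "m \<le> n" for m n
    proof -
      obtain k where "n = m + k" using \<open>m \<le> n\<close> le_Suc_ex by blast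
      then have "dist (y m) (y n) \<le> dist (r m) (r n)"
        using dist_le[of m k] incseqD[OF \<open>incseq r\<close>, of m "m + k"]
        by (simp add: dist_norm norm_minus_commute)
      with M[of m n] that show ?thesis by simp
    qed
    then have "dist (y m) (y n) < e" if "M \<le> m" "M \<le> n" for m n
      using that by (metis dist_commute linear)
    then show "\<exists>M. \<forall>m\<ge>M. \<forall>n\<ge>M. dist (y m) (y n) < e" by blast
  qed
  then obtain l where l: "y \<longlonglongrightarrow> l"
    using Cauchy_convergent convergent_def by blast
  have "star (y n) = y n" for n
    by (induction n) (simp_all add: y0 ySuc star_zero star_scaleR star_add star_mult b)
  then have "star l = l"
    using bounded_linear.tendsto[OF bounded_linear_star l] l LIMSEQ_unique by simp
  moreover have "norm l \<le> 1"
    using y_le r by (intro LIMSEQ_le_const2[OF tendsto_norm[OF l]]) (meson order_trans)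
  moreover have "(1 - l) * (1 - l) = 1 - b"
  proof -
    have "(\<lambda>n. (1/2) *\<^sub>R (b + y n * y n)) \<longlonglongrightarrow> (1/2) *\<^sub>R (b + l * l)"
      by (intro tendsto_intros l)
    moreover have "(\<lambda>n. (1/2) *\<^sub>R (b + y n * y n)) \<longlonglongrightarrow> l"
      using LIMSEQ_Suc[OF l] by (simp add: ySuc)
    ultimately have "(1/2) *\<^sub>R (b + l * l) = l" by (rule LIMSEQ_unique)
    then have "b + l * l = 2 *\<^sub>R l" by (metis scaleR_half_double scaleR_2 scaleR_left_commute)
    then show ?thesis by (simp add: algebra_simps scaleR_2)
  qed
  moreover have "z * l = l * z" if "z * b = b * z" for z
  proof (rule LIMSEQ_unique)
    show "(\<lambda>n. z * y n) \<longlonglongrightarrow> z * l" by (intro tendsto_intros l)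
    show "(\<lambda>n. z * y n) \<longlonglongrightarrow> l * z"
      unfolding comm[OF that] by (intro tendsto_intros l)
  qed
  ultimately show thesis using that by blast
qed

text \<open>For self-adjoint \<open>a\<close> the norm condition says that the spectrum of \<open>a\<close> lies in
  \<open>[0, 2 * t]\<close>; in this form, positive elements visibly form a cone.\<close>

definition positive_element :: "'a::unital_cstar_algebra \<Rightarrow> bool" where
  "positive_element a \<longleftrightarrow> star a = a \<and> (\<exists>t\<ge>0. norm (t *\<^sub>R 1 - a) \<le> t)"

section \<open>The cone of positive elements, square roots and the order norm\<close>

lemma positive_self_adjoint: "positive_element a \<Longrightarrow> star a = a"
  by (simp add: positive_element_def)

lemma positive_add:
  assumes "positive_element a" "positive_element b"
  shows "positive_element (a + b)"
proof -
  obtain s t where "0 \<le> s" "norm (s *\<^sub>R 1 - a) \<le> s" "0 \<le> t" "norm (t *\<^sub>R 1 - b) \<le> t"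
    using assms by (auto simp: positive_element_def)
  moreover have "(s + t) *\<^sub>R 1 - (a + b) = (s *\<^sub>R 1 - a) + (t *\<^sub>R 1 - b)"
    by (simp add: algebra_simps)
  ultimately have "0 \<le> s + t" "norm ((s + t) *\<^sub>R 1 - (a + b)) \<le> s + t"
    by (simp_all only: norm_triangle_mono add_nonneg_nonneg)
  with assms show ?thesis unfolding positive_element_def by (metis star_add)
qed

lemma positive_scaleR:
  assumes "positive_element a" "0 \<le> c"
  shows "positive_element (c *\<^sub>R a)"
proof -
  obtain t where t: "0 \<le> t" "norm (t *\<^sub>R 1 - a) \<le> t"
    using assms by (auto simp: positive_element_def)
  have "(c * t) *\<^sub>R 1 - c *\<^sub>R a = c *\<^sub>R (t *\<^sub>R 1 - a)"
    by (simp add: algebra_simps)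
  with t assms have "0 \<le> c * t" "norm ((c * t) *\<^sub>R 1 - c *\<^sub>R a) \<le> c * t"
    by (simp_all add: mult_left_mono)
  with assms show ?thesis unfolding positive_element_def by (metis star_scaleR)
qed

lemma positive_norm_diff:
  assumes "star a = a"
  shows "positive_element (norm a *\<^sub>R 1 - a)"
  unfolding positive_element_def
  using assms by (auto simp: star_diff star_scaleR star_one intro!: exI[of _ "norm a"])

text \<open>After scaling to norm at most 1, write \<open>1 - h * h = k * k\<close> with
  \<open>k\<close> self-adjoint and commuting with \<open>h\<close>. Then the square of
  \<open>norm k\<close> is at most \<open>norm (k * k + h * h) = norm 1\<close>, so
  \<open>t = 1\<close> witnesses positivity.\<close>

lemma positive_square:
  assumes h: "star h = h"
  shows "positive_element (h * h)"
proof -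
  have "norm (1 - g * g) \<le> 1" if g: "star g = g" "norm g \<le> 1" for g :: 'a
  proof -
    have "norm (g * g) \<le> 1" using g by (simp add: norm_square power_le_one)
    then obtain y where y: "star y = y" "(1 - y) * (1 - y) = 1 - g * g"
      "\<And>z. z * (g * g) = g * g * z \<Longrightarrow> z * y = y * z"
      using sqrt_one_minus_exists[of "g * g"] g by (metis star_mult)
    have k: "star (1 - y) = 1 - y" by (simp add: star_diff star_one y)
    have "g * y = y * g" by (intro y) (simp add: mult.assoc)
    then have "(norm (1 - y))\<^sup>2 \<le> norm ((1 - y) * (1 - y) + g * g)"
      using g by (intro norm_le_sum_squares k) (auto simp: algebra_simps)
    also have "\<dots> \<le> 1" using norm_one_le by (simp add: y)
    finally show ?thesis using norm_square[OF k] by (simp add: y)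
  qed
  from this[of "(1 / norm h) *\<^sub>R h"]
  have "positive_element (((1 / norm h) *\<^sub>R h) * ((1 / norm h) *\<^sub>R h))" if "h \<noteq> 0"
    using h that unfolding positive_element_def by (intro conjI exI[of _ 1]) (auto simp: star_mult star_scaleR)
  then have "positive_element ((norm h)\<^sup>2 *\<^sub>R (((1 / norm h) *\<^sub>R h) * ((1 / norm h) *\<^sub>R h)))" if "h \<noteq> 0"
    using that by (intro positive_scaleR) auto
  moreover have "positive_element (0::'a)"
    unfolding positive_element_def by (auto simp: star_zero)
  ultimately show ?thesis
    by (cases "h = 0") (auto simp: power2_eq_square)
qed

text \<open>Dividing by the witness \<open>t\<close> brings \<open>1 - (1 / t) a\<close> into the
  unit ball, where the iteration applies; \<open>t = 0\<close> forces \<open>a = 0\<close>.\<close>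

lemma positive_sqrt:
  assumes "positive_element a"
  obtains k where "positive_element k" "k * k = a" "\<And>z. z * a = a * z \<Longrightarrow> z * k = k * z"
proof -
  obtain t where t: "0 \<le> t" "norm (t *\<^sub>R 1 - a) \<le> t" and a: "star a = a"
    using assms by (auto simp: positive_element_def)
  show thesis
  proof (cases "t = 0")
    case True
    with t that[of a] assms show thesis by simp
  next
    case False
    with t have t0: "0 < t" by simp
    define b where "b = 1 - (1 / t) *\<^sub>R a"
    have "b = (1 / t) *\<^sub>R (t *\<^sub>R 1 - a)" using t0 by (simp add: b_def scaleR_diff_right)
    then have "norm b \<le> 1" using t t0 by simp
    moreover have "star b = b" by (simp add: b_def star_diff star_one star_scaleR a)
    ultimately obtain y where y: "star y = y" "norm y \<le> 1" "(1 - y) * (1 - y) = 1 - b"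
      "\<And>z. z * b = b * z \<Longrightarrow> z * y = y * z"
      using sqrt_one_minus_exists by blast
    show thesis
    proof (rule that[of "sqrt t *\<^sub>R (1 - y)"])
      have "positive_element (1 - y)"
        using y unfolding positive_element_def by (auto simp: star_diff star_one intro!: exI[of _ 1])
      then show "positive_element (sqrt t *\<^sub>R (1 - y))"
        using t by (intro positive_scaleR) auto
      have "sqrt t *\<^sub>R (1 - y) * (sqrt t *\<^sub>R (1 - y)) = (sqrt t * sqrt t) *\<^sub>R ((1 - y) * (1 - y))"
        by simp
      also have "\<dots> = a" using t0 by (simp only: y) (simp add: b_def)
      finally show "sqrt t *\<^sub>R (1 - y) * (sqrt t *\<^sub>R (1 - y)) = a" .
      fix z assume "z * a = a * z"
      then have "z * y = y * z"
        by (intro y) (simp add: b_def algebra_simps)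
      then show "z * (sqrt t *\<^sub>R (1 - y)) = sqrt t *\<^sub>R (1 - y) * z"
        by (simp add: algebra_simps)
    qed
  qed
qed

text \<open>The roots \<open>k\<close> of \<open>t - a\<close> and \<open>l\<close> of
  \<open>t + a\<close> commute with each other and with \<open>a\<close>, so
  \<open>a * a + (k * l) * (k * l)\<close> is \<open>t\<close> squared times the unit, and its norm
  dominates the square of \<open>norm a\<close>.\<close>

lemma norm_le_order_norm:
  fixes a :: "'a::unital_cstar_algebra"
  assumes pos: "positive_element (t *\<^sub>R 1 - a)" "positive_element (t *\<^sub>R 1 + a)" and a: "star a = a" and t: "0 \<le> t"
  shows "norm a \<le> t"
proof -
  obtain k where k: "positive_element k" "k * k = t *\<^sub>R 1 - a"
    "\<And>z. z * (t *\<^sub>R 1 - a) = (t *\<^sub>R 1 - a) * z \<Longrightarrow> z * k = k * z"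
    using positive_sqrt[OF pos(1)] by blast
  obtain l where l: "positive_element l" "l * l = t *\<^sub>R 1 + a"
    "\<And>z. z * (t *\<^sub>R 1 + a) = (t *\<^sub>R 1 + a) * z \<Longrightarrow> z * l = l * z"
    using positive_sqrt[OF pos(2)] by blast
  have ka: "a * k = k * a" by (intro k) (simp add: algebra_simps)
  have la: "a * l = l * a" by (intro l) (simp add: algebra_simps)
  have kl: "k * l = l * k" by (intro l) (simp add: algebra_simps ka)
  have "a * (k * l) = k * (a * l)" by (simp add: ka flip: mult.assoc)
  then have comm: "a * (k * l) = (k * l) * a" by (simp add: la mult.assoc)
  have lkl: "l * (k * l) = k * (l * l)" by (simp add: kl[symmetric] flip: mult.assoc)
  have "star (k * l) = k * l"
    by (simp add: star_mult positive_self_adjoint k(1) l(1) kl)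
  from norm_le_sum_squares[OF a this comm]
  have "(norm a)\<^sup>2 \<le> norm (a * a + (k * l) * (k * l))" .
  also have "(k * l) * (k * l) = (k * k) * (l * l)"
    by (simp add: mult.assoc lkl)
  also have "a * a + \<dots> = t\<^sup>2 *\<^sub>R 1"
    unfolding k(2) l(2) by (simp add: algebra_simps power2_eq_square)
  also have "norm \<dots> \<le> t\<^sup>2"
    using norm_one_le[where 'a = 'a] by (simp add: mult_left_le)
  finally show ?thesis using t by (simp add: power2_le_iff_abs_le)
qed

lemma positive_antisym:
  assumes "positive_element a" "positive_element (- a)"
  shows "a = 0"
  using norm_le_order_norm[of 0 a] assms by (simp add: positive_self_adjoint)

lemma positive_star_mult_add:
  fixes x :: "'a::unital_cstar_algebra"
  shows "positive_element (star x * x + x * star x)"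
proof -
  \<comment> \<open>\<open>c\<close> is twice the real part of \<open>x\<close> and \<open>d\<close>
    is minus twice its imaginary part.\<close>
  define c where "c = x + star x"
  define d where "d = scaleC \<i> (x - star x)"
  have "star c = c" "star d = d"
    by (simp_all add: c_def d_def star_add star_star star_scaleC_ii star_diff
        scaleC_diff_right add.commute)
  then have "positive_element ((1/2) *\<^sub>R (c * c + d * d))"
    by (intro positive_scaleR positive_add positive_square) auto
  also have "c * c + d * d = 2 *\<^sub>R (star x * x + x * star x)"
    unfolding c_def d_def scaleC_ii_mult by (simp add: algebra_simps scaleR_2)
  finally show ?thesis by simp
qed

text \<open>Kaplansky's theorem. Let \<open>m = \<bar>h\<bar> - h\<close> for \<open>h = star x * x\<close>. Then \<open>y = x * m\<close> satisfies
  \<open>star y * y = - q * q\<close> with \<open>q\<close> self-adjoint, so for \<open>w = y * q\<close> both \<open>star w * w\<close> and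
  \<open>w * star w\<close> are negative although their sum is positive; hence \<open>w\<close>, \<open>q\<close>, \<open>y\<close> and
  finally \<open>m\<close> vanish.\<close>

lemma positive_star_mult:
  fixes x :: "'a::unital_cstar_algebra"
  shows "positive_element (star x * x)"
proof -
  define h where "h = star x * x"
  have h: "star h = h" by (simp add: h_def star_mult star_star)
  obtain s where s: "positive_element s" "s * s = h * h" "h * s = s * h"
    using positive_sqrt[OF positive_square[OF h]] by (metis mult.assoc)
  define m where "m = s - h"
  have m: "star m = m" by (simp add: m_def star_diff h positive_self_adjoint s)
  \<comment> \<open>Here \<open>s\<close> stands for \<bar>h\<bar>. As \<open>s * s = h * h\<close>
    and \<open>h\<close> commutes with \<open>s\<close>, multiplying \<open>m\<close> by
    \<open>h\<close> or by \<open>- s\<close> is the same.\<close>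
  have hm: "h * m = - (s * m)" by (simp add: m_def algebra_simps s)
  have ms: "m * s = s * m" by (simp add: m_def algebra_simps s)
  \<comment> \<open>A root of \<open>s\<close> that commutes with \<open>m\<close> turns
    \<open>m * s * m\<close> into the square of the self-adjoint \<open>r * m\<close>.\<close>
  obtain r where r: "positive_element r" "r * r = s" "m * r = r * m"
    using positive_sqrt[OF s(1)] ms by metis
  define q where "q = r * m"
  have q: "star q = q"
    by (simp add: q_def star_mult m positive_self_adjoint r)
  define y where "y = x * m"
  have "star y * y = m * (h * m)"
    by (simp add: y_def h_def star_mult m mult.assoc)
  also have "\<dots> = - (m * (r * r) * m)" by (simp add: hm r mult.assoc)
  also have "m * (r * r) * m = q * q" by (metis q_def r(3) mult.assoc)
  finally have yy: "star y * y = - (q * q)" .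
  define p where "p = y * star y"
  have p: "star p = p" by (simp add: p_def star_mult star_star)
  define w where "w = y * q"
  have w1: "star w * w = - ((q * q) * (q * q))"
  proof -
    have "star w * w = q * (star y * y) * q" by (simp add: w_def star_mult q mult.assoc)
    then show ?thesis by (simp add: yy mult.assoc)
  qed
  have w2: "w * star w = - (p * p)"
  proof -
    have "w * star w = y * (q * q) * star y" by (simp add: w_def star_mult q mult.assoc)
    also have "q * q = - (star y * y)" by (simp add: yy)
    finally show ?thesis by (simp add: p_def mult.assoc)
  qed
  have qq: "star (q * q) = q * q" by (simp add: star_mult q)
  \<comment> \<open>\<open>- n\<close> is \<open>star w * w + w * star w\<close>, hence positive,
    while \<open>n\<close> is a sum of squares.\<close>
  define n where "n = (q * q) * (q * q) + p * p"
  have "positive_element (- n)"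
    using positive_star_mult_add[of w] by (simp add: w1 w2 n_def)
  moreover have "positive_element n"
    unfolding n_def by (intro positive_add positive_square qq p)
  ultimately have "n = 0" by (rule positive_antisym[rotated])
  then have "(q * q) * (q * q) = - (p * p)"
    unfolding n_def by (simp add: eq_neg_iff_add_eq_0)
  then have "(q * q) * (q * q) = 0"
    using positive_antisym[of "(q * q) * (q * q)"] positive_square[OF qq] positive_square[OF p]
    by simp
  then have "q * q = 0" using square_eq_0[OF qq] by simp
  then have "y = 0" using cstar_identity[of y] yy by simp
  then have "h * m = 0" by (simp add: h_def y_def mult.assoc)
  then have "m * m = 0" using hm by (simp add: m_def left_diff_distrib)
  then have "m = 0" using square_eq_0[OF m] by simp
  then show ?thesis using s(1) by (simp add: m_def h_def)
qed

section \<open>States\<close>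

lemma
  assumes "\<mu> \<in> state_space"
  shows state_add: "\<mu> (x + y) = \<mu> x + \<mu> y"
    and state_scaleC: "\<mu> (scaleC z x) = z * \<mu> x"
    and state_one: "\<mu> 1 = 1"
    and state_star_mult: "\<mu> (star x * x) \<in> \<real>\<^sub>\<ge>\<^sub>0"
  using assms by (simp_all add: state_space_def)

lemma state_scaleR: "\<mu> \<in> state_space \<Longrightarrow> \<mu> (r *\<^sub>R x) = of_real r * \<mu> x"
  by (metis scaleC_of_real state_scaleC)

lemma state_minus: "\<mu> \<in> state_space \<Longrightarrow> \<mu> (- x) = - \<mu> x"
  using state_scaleR[of \<mu> "- 1" x] by simp

lemma state_diff: "\<mu> \<in> state_space \<Longrightarrow> \<mu> (x - y) = \<mu> x - \<mu> y"
  using state_add[of \<mu> x "- y"] state_minus[of \<mu> y] by simp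

text \<open>States are required to be nonnegative on \<open>star x * x\<close> only; square roots
  extend this to the whole cone.\<close>

lemma state_positive:
  assumes "\<mu> \<in> state_space" "positive_element a"
  shows "\<mu> a \<in> \<real>\<^sub>\<ge>\<^sub>0"
  using positive_sqrt[OF assms(2)] state_star_mult[OF assms(1)] positive_self_adjoint by metis

text \<open>Both \<open>norm a - a\<close> and \<open>norm a + a\<close> are positive, so \<mu> is
  nonnegative on them.\<close>

lemma state_self_adjoint:
  assumes \<mu>: "\<mu> \<in> state_space" and a: "star a = a"
  shows "Im (\<mu> a) = 0" and "cmod (\<mu> a) \<le> norm a"
proof -
  have "positive_element (norm a *\<^sub>R 1 - a)"
    using a by (rule positive_norm_diff)
  from state_positive[OF \<mu> this]
  have 1: "of_real (norm a) - \<mu> a \<in> \<real>\<^sub>\<ge>\<^sub>0"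
    by (simp add: state_diff state_scaleR state_one \<mu>)
  have "positive_element (norm (- a) *\<^sub>R 1 - (- a))"
    using a by (intro positive_norm_diff) (simp add: star_minus)
  from state_positive[OF \<mu> this]
  have 2: "of_real (norm a) + \<mu> a \<in> \<real>\<^sub>\<ge>\<^sub>0"
    by (simp add: state_add state_scaleR state_one \<mu>)
  from 1 show "Im (\<mu> a) = 0" by (simp add: complex_nonneg_Reals_iff)
  with 1 2 show "cmod (\<mu> a) \<le> norm a"
    by (simp add: complex_nonneg_Reals_iff cmod_eq_Re)
qed

text \<open>The factor 2 is the cost of splitting \<open>x\<close> into self-adjoint parts; any
  constant serves the compactness argument.\<close>

lemma state_bounded:
  assumes \<mu>: "\<mu> \<in> state_space"
  shows "cmod (\<mu> x) \<le> 2 * norm x"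
proof -
  define c where "c = x + star x"
  define d where "d = scaleC \<i> (x - star x)"
  have sa: "star c = c" "star d = d"
    by (simp_all add: c_def d_def star_add star_star star_scaleC_ii star_diff
        scaleC_diff_right add.commute)
  have "scaleC \<i> d = - (x - star x)"
    by (simp add: d_def scaleC_scaleC scaleC_minus_one)
  then have "2 *\<^sub>R x = c - scaleC \<i> d"
    by (simp add: c_def scaleR_2)
  then have "2 * \<mu> x = \<mu> c - \<i> * \<mu> d"
    using \<mu> state_scaleR[of \<mu> 2 x] by (simp add: state_diff state_scaleC)
  then have "2 * cmod (\<mu> x) = cmod (\<mu> c - \<i> * \<mu> d)"
    by (metis norm_mult norm_numeral)
  also have "\<dots> \<le> cmod (\<mu> c) + cmod (\<mu> d)"
    by (rule order_trans[OF norm_triangle_ineq4]) (simp add: norm_mult)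
  also have "\<dots> \<le> norm c + norm d"
    by (intro add_mono state_self_adjoint \<mu> sa)
  also have "\<dots> \<le> 4 * norm x"
    using norm_triangle_ineq[of x "star x"] norm_triangle_ineq4[of x "star x"]
    by (simp add: c_def d_def norm_scaleC norm_star)
  finally show ?thesis by simp
qed

text \<open>The functional \<open>\<lambda>x. INF t\<ge>0. norm (Re x + t) - t\<close>, obtained by shifting the norm along
  the unit, computes the upper end of the spectrum of the real part of \<open>x\<close>. A linear functional
  below it is unital, and a further shift makes it attain the norm of a given element.\<close>

lemma state_attaining_norm:
  fixes a :: "'a::unital_cstar_algebra"
  assumes a: "star a = a" and ne: "(1::'a) \<noteq> 0"
  obtains \<mu> where "\<mu> \<in> state_space" "norm a \<le> cmod (\<mu> a)"
proof -
  define n where "n x = norm (x + star x) / 2" for x :: 'a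
  define p where "p = shift n 1"
  have n_sa: "n x = norm x" if "star x = x" for x
    using that by (simp add: n_def flip: scaleR_2)
  have norm1: "norm (1::'a) = 1"
    using norm_square[of "1::'a"] star_one[where 'a = 'a] ne by (simp add: power2_eq_square)
  then have n1: "n 1 = 1" by (simp add: n_sa star_one)
  have n: "sublinear n"
  proof (rule sublinearI)
    fix x y :: 'a
    have "x + y + star (x + y) = (x + star x) + (y + star y)"
      by (simp add: star_add)
    then have "norm (x + y + star (x + y)) \<le> norm (x + star x) + norm (y + star y)"
      by (simp only: norm_triangle_ineq)
    then show "n (x + y) \<le> n x + n y" by (simp add: n_def)
  next
    fix t :: real and x :: 'a assume "0 < t"
    then show "n (t *\<^sub>R x) \<le> t * n x"
      by (simp add: n_def star_scaleR flip: scaleR_add_right)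
  qed
  then have p: "sublinear p" unfolding p_def by (rule sublinear_shift)
  \<comment> \<open>A parameter \<open>t\<close> that brings the infimum below \<open>r\<close>
    gives \<open>norm (b + t) < t + r\<close>, so \<open>t + r\<close> witnesses positivity of
    \<open>r - b\<close>.\<close>
  have below: "positive_element (r *\<^sub>R 1 - b)" if b: "star b = b" and lt: "p b < r" for b r
  proof -
    obtain t where t: "0 \<le> t" "n (b + t *\<^sub>R 1) - t * n 1 < r"
      using shift_greatest[of r n b 1] lt unfolding p_def by (meson not_le)
    then have "norm (b + t *\<^sub>R 1) < t + r"
      by (simp add: n1 n_sa star_add star_scaleR star_one b)
    then have "0 \<le> t + r" "norm ((t + r) *\<^sub>R 1 - (r *\<^sub>R 1 - b)) \<le> t + r"
      using norm_ge_zero[of "b + t *\<^sub>R 1"] by (linarith, simp add: algebra_simps)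
    then show ?thesis
      unfolding positive_element_def by (auto simp: star_diff star_scaleR star_one b)
  qed
  \<comment> \<open>Otherwise \<open>a\<close> lies between \<open>- r\<close> and \<open>r\<close>
    in the order for some \<open>r < norm a\<close>, contradicting
    \<open>norm_le_order_norm\<close>.\<close>
  have "norm a \<le> p a \<or> norm a \<le> p (- a)"
  proof (rule ccontr)
    assume "\<not> ?thesis"
    then obtain r where r: "p a < r" "p (- a) < r" "r < norm a"
      using dense[of "max (p a) (p (- a))" "norm a"] by auto
    moreover have "0 \<le> r"
      using sublinear_ge_minus[OF p, of a] r by linarith
    ultimately have "norm a \<le> r"
      using below[of a r] below[of "- a" r] a
      by (intro norm_le_order_norm) (auto simp: star_minus)
    with r show False by simp
  qed
  then obtain b where b: "b = a \<or> b = - a" "norm a \<le> p b" by blast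
  obtain f where f: "linear f" "\<And>x. f x \<le> shift p b x"
    using Hahn_Banach_sublinear[OF sublinear_shift[OF p]] by blast
  have fp: "f x \<le> p x" for x
    using f(2) shift_le_self[OF p] order_trans by blast
  have fn: "f x \<le> n x" for x
    using fp shift_le_self[OF n] order_trans unfolding p_def by blast
  have f_b: "norm a \<le> f b"
    using f(2)[of "- b"] shift_uminus_le[OF p, of b] b(2) by (simp add: linear_neg[OF f(1)])
  have f1: "f 1 = 1"
    using fn[of 1] fp[of "- 1"] shift_uminus_le[OF n, of 1]
    by (simp add: n1 linear_neg[OF f(1)] p_def)
  \<comment> \<open>The functional \<open>n\<close> sees only the real part, which vanishes for \<i>
    times a self-adjoint element.\<close>
  have f_skew: "f (scaleC \<i> x) = 0" if "star x = x" for x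
    using fn[of "scaleC \<i> x"] fn[of "- scaleC \<i> x"] that
    by (simp add: n_def star_scaleC_ii star_minus linear_neg[OF f(1)])
  have scaleC_split: "scaleC z x = Re z *\<^sub>R x + Im z *\<^sub>R scaleC \<i> x" for z and x :: 'a
  proof -
    have "scaleC z x = scaleC (of_real (Re z) + of_real (Im z) * \<i>) x"
      by (simp add: complex_eq mult.commute flip: complex_eq)
    also have "\<dots> = Re z *\<^sub>R x + Im z *\<^sub>R scaleC \<i> x"
      by (simp add: scaleC_add_left scaleC_of_real flip: scaleC_scaleC)
    finally show ?thesis .
  qed
  \<comment> \<open>The standard complex-linear functional whose real part is
    \<open>f\<close>.\<close>
  define \<mu> where "\<mu> x = Complex (f x) (- f (scaleC \<i> x))" for x
  have "\<mu> \<in> state_space"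
    unfolding state_space_def
  proof (intro CollectI conjI allI)
    fix x y
    show "\<mu> (x + y) = \<mu> x + \<mu> y"
      by (simp add: \<mu>_def complex_eq_iff scaleC_add_right linear_add[OF f(1)])
  next
    fix z and x :: 'a
    have "scaleC \<i> (scaleC z x) = Re z *\<^sub>R scaleC \<i> x - Im z *\<^sub>R x"
      unfolding scaleC_split[of z x]
      by (simp add: scaleC_add_right linear_scale[OF linear_scaleC] scaleC_scaleC scaleC_minus_one)
    then show "\<mu> (scaleC z x) = z * \<mu> x"
      by (simp add: \<mu>_def complex_eq_iff scaleC_split[of z x] linear_add[OF f(1)]
          linear_diff[OF f(1)] linear_scale[OF f(1)])
  next
    fix x :: 'a
    have sa: "star (star x * x) = star x * x" by (simp add: star_mult star_star)
    obtain t where t: "norm (t *\<^sub>R 1 - star x * x) \<le> t"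
      using positive_star_mult[of x] by (auto simp: positive_element_def)
    have "f (t *\<^sub>R 1 - star x * x) \<le> t"
      using fn[of "t *\<^sub>R 1 - star x * x"] t by (simp add: n_sa star_diff star_scaleR star_one sa)
    then have "0 \<le> f (star x * x)"
      by (simp add: linear_diff[OF f(1)] linear_scale[OF f(1)] f1)
    then show "\<mu> (star x * x) \<in> \<real>\<^sub>\<ge>\<^sub>0"
      by (simp add: \<mu>_def complex_nonneg_Reals_iff f_skew sa)
  next
    show "\<mu> 1 = 1"
      by (simp add: \<mu>_def complex_eq_iff f1 f_skew star_one)
  qed
  moreover have "norm a \<le> cmod (\<mu> a)"
  proof -
    have "norm a \<le> \<bar>f a\<bar>"
      using b(1) f_b by (auto simp: linear_neg[OF f(1)])
    also have "\<dots> \<le> cmod (\<mu> a)" using abs_Re_le_cmod[of "\<mu> a"] by (simp add: \<mu>_def)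
    finally show ?thesis .
  qed
  ultimately show thesis using that by blast
qed

text \<open>Banach-Alaoglu: states lie in a product of discs, compact by Tychonoff, and are cut out
  by closed conditions on coordinates.\<close>

lemma compact_space_weak_star:
  "compact_space (weak_star_topology :: ('a::unital_cstar_algebra \<Rightarrow> complex) topology)"
proof -
  let ?S = "state_space :: ('a \<Rightarrow> complex) set"
  have "closed {\<mu> :: 'a \<Rightarrow> complex. \<mu> y \<in> \<real>\<^sub>\<ge>\<^sub>0}" for y
    using closed_vimage[OF closed_nonneg_Reals_complex continuous_on_product_coordinates[of y]]
    by (simp add: vimage_def)
  then have "closed ?S"
    unfolding state_space_def
    by (intro closed_Collect_conj closed_Collect_all closed_Collect_eq continuous_intros) auto
  moreover have "compact (PiE UNIV (\<lambda>x::'a. cball (0::complex) (2 * norm x)))"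
    by (metis compactin_PiE compactin_euclidean_iff compact_cball euclidean_product_topology)
  moreover have "?S \<subseteq> PiE UNIV (\<lambda>x. cball 0 (2 * norm x))"
    using state_bounded by auto
  ultimately have "compact ?S"
    by (metis compact_Int_closed inf.absorb_iff2)
  then show ?thesis
    unfolding weak_star_topology_def
    by (intro compact_space_subtopology) (simp add: euclidean_product_topology)
qed

section \<open>Morphisms\<close>

lemma
  assumes "unital_star_morphism \<phi>"
  shows morphism_linear: "linear \<phi>"
    and morphism_mult: "\<phi> (x * y) = \<phi> x * \<phi> y"
    and morphism_star: "\<phi> (star x) = star (\<phi> x)"
    and morphism_one: "\<phi> 1 = 1"
  using assms by (auto simp: unital_star_morphism_def scaleC_of_real[symmetric] intro!: linearI)

lemma morphism_positive:
  assumes \<phi>: "unital_star_morphism \<phi>" and a: "positive_element a"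
  shows "positive_element (\<phi> a)"
proof -
  obtain k where k: "positive_element k" "k * k = a"
    using positive_sqrt[OF a] by blast
  have "positive_element (\<phi> k * \<phi> k)"
    using k(1) by (intro positive_square) (metis morphism_star[OF \<phi>] positive_self_adjoint)
  then show ?thesis
    using k(2) by (simp flip: morphism_mult[OF \<phi>])
qed

text \<open>Continuity comes from the algebra: a morphism preserves squares, hence the positivity of
  \<open>norm a - a\<close> and \<open>norm a + a\<close>.\<close>

lemma morphism_contractive:
  assumes \<phi>: "unital_star_morphism \<phi>" and a: "star a = a"
  shows "norm (\<phi> a) \<le> norm a"
proof (rule norm_le_order_norm)
  note lin = morphism_linear[OF \<phi>]
  have "positive_element (\<phi> (norm b *\<^sub>R 1 - b))" if "star b = b" for b
    using that by (intro morphism_positive[OF \<phi>] positive_norm_diff)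
  from this[of a] this[of "- a"]
  show "positive_element (norm a *\<^sub>R 1 - \<phi> a)" "positive_element (norm a *\<^sub>R 1 + \<phi> a)"
    using a by (simp_all add: star_minus linear_diff[OF lin] linear_add[OF lin]
        linear_scale[OF lin] morphism_one[OF \<phi>])
  show "star (\<phi> a) = \<phi> a" by (metis a morphism_star[OF \<phi>])
qed simp

section \<open>Lip-norms\<close>

lemma closed_self_adjoint: "closed (self_adjoint :: 'a::unital_cstar_algebra set)"
  unfolding self_adjoint_def
  by (intro closed_Collect_eq linear_continuous_on bounded_linear_star continuous_on_id)

lemma
  assumes "quantum_compact_metric_space L"
  shows Lip_dom_subspace: "subspace (Lip_dom L)"
    and Lip_add: "a \<in> Lip_dom L \<Longrightarrow> b \<in> Lip_dom L \<Longrightarrow> L (a + b) \<le> L a + L b"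
    and Lip_scaleR: "a \<in> Lip_dom L \<Longrightarrow> L (t *\<^sub>R a) = ennreal \<bar>t\<bar> * L a"
    and Lip_null: "{a \<in> Lip_dom L. L a = 0} = range (\<lambda>t. t *\<^sub>R 1)"
    and Lip_metrizes: "metrizes (mk_dist L) weak_star_topology"
  using assms by (simp_all add: quantum_compact_metric_space_def)

lemma
  assumes "quantum_compact_metric_space L"
  shows Lip_dom_const: "t *\<^sub>R 1 \<in> Lip_dom L" and Lip_const: "L (t *\<^sub>R 1) = 0"
  using Lip_null[OF assms] by blast+

lemma Lip_add_const_le:
  assumes "quantum_compact_metric_space L" "a \<in> Lip_dom L"
  shows "L (a + t *\<^sub>R 1) \<le> L a"
  using Lip_add[OF assms Lip_dom_const[OF assms(1)]] by (simp add: Lip_const[OF assms(1)])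

lemma Lip_dom_self_adjoint: "a \<in> Lip_dom L \<Longrightarrow> star a = a"
  by (simp add: Lip_dom_def self_adjoint_def)

text \<open>Scaling by \<open>1 / c\<close> reduces level \<open>c\<close> to level 1, whose set is
  closed in the closed set \<open>self_adjoint\<close>.\<close>

lemma closed_Lip_le:
  assumes L: "quantum_compact_metric_space L" and lsc: "lower_semicontinuous_Lip L" and c: "0 < c"
  shows "closed {a \<in> Lip_dom L. L a \<le> ennreal c}"
proof -
  let ?U = "{a \<in> Lip_dom L. L a \<le> 1}"
  have "closed ?U"
    using lsc closed_self_adjoint unfolding lower_semicontinuous_Lip_def
    by (rule closedin_closed_trans)
  then have "closed ((\<lambda>a. (1 / c) *\<^sub>R a) -` ?U)"
    by (intro continuous_closed_vimage continuous_intros)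
  moreover have "a \<in> Lip_dom L \<and> L a \<le> ennreal c \<longleftrightarrow> (1 / c) *\<^sub>R a \<in> ?U" for a
  proof -
    have dom: "a \<in> Lip_dom L \<longleftrightarrow> (1 / c) *\<^sub>R a \<in> Lip_dom L"
      using subspace_scale[OF Lip_dom_subspace[OF L], of a "1 / c"]
        subspace_scale[OF Lip_dom_subspace[OF L], of "(1 / c) *\<^sub>R a" c] c by auto
    have "L a \<le> ennreal c \<longleftrightarrow> ennreal (1 / c) * L a \<le> 1" if a: "a \<in> Lip_dom L"
    proof -
      obtain r where r: "0 \<le> r" "L a = ennreal r"
        using a by (cases "L a") (auto simp: Lip_dom_def)
      with c show ?thesis
        by (simp add: field_simps flip: ennreal_mult ennreal_1)
    qed
    with dom show ?thesis using Lip_scaleR[OF L, of a "1 / c"] c by auto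
  qed
  then have "{a \<in> Lip_dom L. L a \<le> ennreal c} = (\<lambda>a. (1 / c) *\<^sub>R a) -` ?U" by blast
  ultimately show ?thesis by simp
qed

text \<open>A compact metric space is bounded; finiteness of \<open>mk_dist\<close> makes its
  passage to real numbers lossless.\<close>

lemma mk_dist_bounded:
  fixes L :: "'a::unital_cstar_algebra \<Rightarrow> ennreal"
  assumes L: "quantum_compact_metric_space L"
  obtains D where "0 \<le> D"
    "\<And>\<mu> \<nu> a. \<mu> \<in> state_space \<Longrightarrow> \<nu> \<in> state_space \<Longrightarrow> a \<in> Lip_dom L \<Longrightarrow> L a \<le> 1
      \<Longrightarrow> cmod (\<mu> a - \<nu> a) \<le> D"
proof -
  let ?W = "weak_star_topology :: ('a \<Rightarrow> complex) topology"
  let ?d = "\<lambda>\<mu> \<nu>. enn2real (mk_dist L \<mu> \<nu>)"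
  have W: "topspace ?W = state_space"
    by (simp add: weak_star_topology_def)
  have fin: "\<And>\<mu> \<nu>. \<mu> \<in> state_space \<Longrightarrow> \<nu> \<in> state_space \<Longrightarrow> mk_dist L \<mu> \<nu> < \<infinity>"
    and "Metric_space state_space ?d" and top: "Metric_space.mtopology state_space ?d = ?W"
    using Lip_metrizes[OF L] by (simp_all add: metrizes_def W)
  then interpret Metric_space state_space ?d by simp
  have "compactin mtopology state_space"
    using compact_space_weak_star[where 'a = 'a] by (simp add: compact_space_def W top)
  then have "mbounded state_space" by (rule compactin_imp_mbounded)
  then obtain D where D: "0 < D" "\<And>\<mu> \<nu>. \<mu> \<in> state_space \<Longrightarrow> \<nu> \<in> state_space \<Longrightarrow> ?d \<mu> \<nu> \<le> D"
    by (auto simp: mbounded_alt_pos)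
  show thesis
  proof (rule that)
    show "0 \<le> D" using D by simp
    fix \<mu> \<nu> :: "'a \<Rightarrow> complex" and a
    assume *: "\<mu> \<in> state_space" "\<nu> \<in> state_space" "a \<in> Lip_dom L" "L a \<le> 1"
    have "ennreal (cmod (\<mu> a - \<nu> a)) \<le> mk_dist L \<mu> \<nu>"
      unfolding mk_dist_def using * by (intro SUP_upper) auto
    also have "\<dots> = ennreal (?d \<mu> \<nu>)"
      using fin[OF *(1,2)] by simp
    also have "\<dots> \<le> ennreal D"
      using D(2)[OF *(1,2)] by (rule ennreal_leI)
    finally show "cmod (\<mu> a - \<nu> a) \<le> D" using D(1) by simp
  qed
qed

text \<open>Fix a state \<nu> and subtract \<nu>(a) from \<open>a\<close>. A state \<mu> attaining
  the norm of the result turns that norm into \<open>cmod (\<mu> a - \<nu> a)\<close>.\<close>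

lemma Lip_ball_bounded_mod_const:
  fixes L :: "'a::unital_cstar_algebra \<Rightarrow> ennreal"
  assumes L: "quantum_compact_metric_space L"
  obtains D where "0 \<le> D"
    "\<And>a. a \<in> Lip_dom L \<Longrightarrow> L a \<le> 1 \<Longrightarrow> \<exists>t. norm (a - t *\<^sub>R 1) \<le> D"
proof (cases "(1::'a) = 0")
  \<comment> \<open>The zero algebra has no states and is treated apart.\<close>
  case True
  then have "x = 0" for x :: 'a by (metis mult_1_left mult_zero_left)
  then have "norm (a - 0 *\<^sub>R 1) \<le> 0" for a :: 'a by (metis norm_zero order_refl)
  then show thesis using that[of 0] by blast
next
  case False
  obtain D where D: "0 \<le> D"
    "\<And>\<mu> \<nu> a. \<mu> \<in> state_space \<Longrightarrow> \<nu> \<in> state_space \<Longrightarrow> a \<in> Lip_dom L \<Longrightarrow> L a \<le> 1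
      \<Longrightarrow> cmod (\<mu> a - \<nu> a) \<le> D"
    using mk_dist_bounded[OF L] by blast
  obtain \<nu> :: "'a \<Rightarrow> complex" where \<nu>: "\<nu> \<in> state_space"
    using state_attaining_norm[OF star_one False] by blast
  show thesis
  proof (rule that[OF D(1)])
    fix a assume a: "a \<in> Lip_dom L" "L a \<le> 1"
    define t where "t = Re (\<nu> a)"
    have sa: "star a = a" using a(1) by (rule Lip_dom_self_adjoint)
    then have t: "of_real t = \<nu> a"
      using state_self_adjoint(1)[OF \<nu>] by (simp add: t_def complex_eq_iff)
    have "star (a - t *\<^sub>R 1) = a - t *\<^sub>R 1"
      by (simp add: sa star_diff star_scaleR star_one)
    then obtain \<mu> where \<mu>: "\<mu> \<in> state_space" "norm (a - t *\<^sub>R 1) \<le> cmod (\<mu> (a - t *\<^sub>R 1))"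
      using state_attaining_norm False by blast
    note \<mu>(2)
    also have "\<mu> (a - t *\<^sub>R 1) = \<mu> a - \<nu> a"
      by (simp add: state_diff state_scaleR state_one \<mu>(1) t)
    also have "cmod \<dots> \<le> D" using D(2) \<mu>(1) \<nu> a by blast
    finally show "\<exists>t. norm (a - t *\<^sub>R 1) \<le> D" by blast
  qed
qed

text \<open>Some \<open>F m\<close> contains a relative ball of \<open>K\<close> around a point
  \<open>a\<close>. Shrinking the bounded convex set \<open>K\<close> towards \<open>a\<close>
  brings it into that ball.\<close>

lemma Baire_convex:
  fixes K :: "'v::banach set" and F :: "nat \<Rightarrow> 'v set"
  assumes K: "closed K" "convex K" "bounded K" "K \<noteq> {}"
    and F: "\<And>m. closed (F m)" "K \<subseteq> (\<Union>m. F m)"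
  obtains m a \<delta> where "a \<in> K" "0 < \<delta>" "\<delta> \<le> (1::real)"
    "\<And>x. x \<in> K \<Longrightarrow> (1 - \<delta>) *\<^sub>R a + \<delta> *\<^sub>R x \<in> F m"
proof -
  let ?X = "top_of_set K"
  have "completely_metrizable_space ?X"
    using K(1) by (simp add: completely_metrizable_space_closedin completely_metrizable_space_euclidean)
  moreover have "?X interior_of (\<Union>m. K \<inter> F m) = K"
    using F(2) interior_of_topspace[of ?X] by (simp add: Int_absorb2 flip: Int_UN_distrib)
  moreover have "closedin ?X (K \<inter> F m)" for m
    using F(1) by (rule closedin_closed_Int)
  ultimately obtain m where "?X interior_of (K \<inter> F m) \<noteq> {}"
    using Baire_category_alt[of ?X "range (\<lambda>m. K \<inter> F m)"] K(4) by auto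
  then obtain a where a: "a \<in> ?X interior_of (K \<inter> F m)" by blast
  have sub: "?X interior_of (K \<inter> F m) \<subseteq> K \<inter> F m" by (rule interior_of_subset)
  with a have aK: "a \<in> K" by blast
  have "openin ?X (?X interior_of (K \<inter> F m))" by (rule openin_interior_of)
  with a obtain e where "0 < e" "ball a e \<inter> K \<subseteq> ?X interior_of (K \<inter> F m)"
    unfolding openin_contains_ball by blast
  with sub have e: "0 < e" "ball a e \<inter> K \<subseteq> F m" by blast+
  obtain B where B: "0 < B" "\<And>x. x \<in> K \<Longrightarrow> norm x \<le> B"
    using K(3) bounded_pos by blast
  \<comment> \<open>Points of \<open>K\<close> are at distance at most \<open>2 * B\<close>, so the
    shrunken ones lie within \<open>e / 2\<close> of \<open>a\<close>.\<close>
  define \<delta> where "\<delta> = min 1 (e / (4 * B))"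
  have \<delta>: "0 < \<delta>" "\<delta> \<le> 1" "\<delta> \<le> e / (4 * B)"
    using e(1) B(1) by (auto simp: \<delta>_def)
  show thesis
  proof (rule that[OF aK \<delta>(1,2)])
    fix x assume x: "x \<in> K"
    let ?y = "(1 - \<delta>) *\<^sub>R a + \<delta> *\<^sub>R x"
    have "?y \<in> K" using K(2) aK x \<delta> by (intro convexD) auto
    moreover have "dist a ?y < e"
    proof -
      have "a - ?y = \<delta> *\<^sub>R (a - x)" by (simp add: algebra_simps)
      then have "dist a ?y = \<delta> * norm (a - x)" using \<delta>(1) by (simp add: dist_norm)
      also have "norm (a - x) \<le> 2 * B"
        using norm_triangle_ineq4[of a x] B(2)[OF aK] B(2)[OF x] by simp
      then have "\<delta> * norm (a - x) \<le> e / (4 * B) * (2 * B)"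
        using \<delta> B(1) e(1) by (intro mult_mono) auto
      also have "\<dots> < e" using B(1) e(1) by simp
      finally show ?thesis .
    qed
    ultimately show "?y \<in> F m" using e(2) by auto
  qed
qed

lemma Lip_bounded_on_ball:
  fixes L\<^sub>A :: "'a::unital_cstar_algebra \<Rightarrow> ennreal"
    and L\<^sub>B :: "'b::unital_cstar_algebra \<Rightarrow> ennreal"
  assumes A: "quantum_compact_metric_space L\<^sub>A" "lower_semicontinuous_Lip L\<^sub>A"
    and B: "quantum_compact_metric_space L\<^sub>B" "lower_semicontinuous_Lip L\<^sub>B"
    and \<phi>: "unital_star_morphism \<phi>" "\<phi> ` Lip_dom L\<^sub>A \<subseteq> Lip_dom L\<^sub>B" and D: "0 \<le> D"
  obtains M where "0 \<le> M"
    "\<And>a. a \<in> Lip_dom L\<^sub>A \<Longrightarrow> L\<^sub>A a \<le> 1 \<Longrightarrow> norm a \<le> D \<Longrightarrow> L\<^sub>B (\<phi> a) \<le> ennreal M"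
proof -
  note lin = morphism_linear[OF \<phi>(1)]
  define K where "K = {a \<in> Lip_dom L\<^sub>A. L\<^sub>A a \<le> ennreal 1} \<inter> cball 0 D"
  \<comment> \<open>\<open>Suc m\<close> keeps the level positive, as \<open>closed_Lip_le\<close>
    requires.\<close>
  define F where "F m = {a \<in> K. L\<^sub>B (\<phi> a) \<le> ennreal (Suc m)}" for m :: nat
  have K_dom: "a \<in> Lip_dom L\<^sub>A" "\<phi> a \<in> Lip_dom L\<^sub>B" if "a \<in> K" for a
    using that \<phi>(2) by (auto simp: K_def)
  have "closed K"
    unfolding K_def by (intro closed_Int closed_Lip_le A closed_cball) simp
  moreover have "convex K"
    unfolding K_def
  proof (rule convex_Int[OF convexI convex_cball])
    fix x y and u v :: real
    assume x: "x \<in> {a \<in> Lip_dom L\<^sub>A. L\<^sub>A a \<le> ennreal 1}" and y: "y \<in> {a \<in> Lip_dom L\<^sub>A. L\<^sub>A a \<le> ennreal 1}"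
      and uv: "0 \<le> u" "0 \<le> v" "u + v = 1"
    have dom: "u *\<^sub>R x \<in> Lip_dom L\<^sub>A" "v *\<^sub>R y \<in> Lip_dom L\<^sub>A"
      using x y by (auto intro: subspace_scale Lip_dom_subspace A)
    have "L\<^sub>A (u *\<^sub>R x + v *\<^sub>R y) \<le> ennreal u * L\<^sub>A x + ennreal v * L\<^sub>A y"
      using Lip_add[OF A(1) dom] x y uv by (simp add: Lip_scaleR[OF A(1)])
    also have "\<dots> \<le> ennreal u * 1 + ennreal v * 1"
      using x y by (intro add_mono mult_left_mono) auto
    also have "\<dots> = ennreal 1" using uv by (simp flip: ennreal_plus)
    finally show "u *\<^sub>R x + v *\<^sub>R y \<in> {a \<in> Lip_dom L\<^sub>A. L\<^sub>A a \<le> ennreal 1}"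
      using dom by (auto intro: subspace_add Lip_dom_subspace A)
  qed
  moreover have "bounded K" unfolding K_def by (simp add: bounded_Int)
  moreover have "K \<noteq> {}"
    using Lip_dom_const[OF A(1), of 0] Lip_const[OF A(1), of 0] D by (auto simp: K_def)
  moreover have "closed (F m)" for m
  proof -
    have "continuous_on K \<phi>"
    proof (rule continuous_onI)
      fix x e assume x: "x \<in> K" and e: "(0::real) < e"
      have "dist (\<phi> y) (\<phi> x) \<le> dist y x" if "y \<in> K" for y
        using morphism_contractive[OF \<phi>(1), of "y - x"] K_dom[OF x] K_dom[OF that]
        by (simp add: dist_norm Lip_dom_self_adjoint star_diff linear_diff[OF lin])
      with e show "\<exists>d>0. \<forall>y\<in>K. dist y x < d \<longrightarrow> dist (\<phi> y) (\<phi> x) \<le> e"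
        by (intro exI[of _ e]) (force intro: order_trans less_imp_le)
    qed
    then have "closed (K \<inter> \<phi> -` {b \<in> Lip_dom L\<^sub>B. L\<^sub>B b \<le> ennreal (Suc m)})"
      using \<open>closed K\<close> by (intro continuous_closed_preimage closed_Lip_le B) auto
    also have "K \<inter> \<phi> -` {b \<in> Lip_dom L\<^sub>B. L\<^sub>B b \<le> ennreal (Suc m)} = F m"
      using K_dom by (auto simp: F_def)
    finally show ?thesis .
  qed
  moreover have "K \<subseteq> (\<Union>m. F m)"
  proof
    fix a assume a: "a \<in> K"
    then obtain r where "L\<^sub>B (\<phi> a) = ennreal r"
      using K_dom(2)[OF a] by (cases "L\<^sub>B (\<phi> a)") (auto simp: Lip_dom_def)
    moreover obtain m where "r \<le> real m" using real_arch_simple by blast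
    then have "ennreal r \<le> ennreal (Suc m)" by (intro ennreal_leI) simp
    ultimately have "a \<in> F m" using a by (simp add: F_def)
    then show "a \<in> (\<Union>m. F m)" by blast
  qed
  ultimately obtain m a \<delta> where a: "a \<in> K" and \<delta>: "0 < \<delta>" "\<delta> \<le> (1::real)"
    and Fm: "\<And>x. x \<in> K \<Longrightarrow> (1 - \<delta>) *\<^sub>R a + \<delta> *\<^sub>R x \<in> F m"
    by (rule Baire_convex) blast
  \<comment> \<open>Solving \<open>c = (1 - \<delta>) a + \<delta> x\<close> for \<open>x\<close>
    gives \<open>x = (1 / \<delta>) c - s a\<close>.\<close>
  define s where "s = (1 - \<delta>) / \<delta>"
  have s: "0 \<le> s" using \<delta> by (simp add: s_def)
  have "L\<^sub>B (\<phi> x) \<le> ennreal ((1 / \<delta> + s) * Suc m)" if x: "x \<in> K" for x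
  proof -
    define c where "c = (1 - \<delta>) *\<^sub>R a + \<delta> *\<^sub>R x"
    \<comment> \<open>The choice \<open>x = a\<close> in \<open>Fm\<close> shows that
      \<open>a\<close> itself belongs to \<open>F m\<close>.\<close>
    have "c \<in> F m" "a \<in> F m"
      using Fm[OF x] Fm[OF a] by (simp_all add: c_def flip: scaleR_add_left)
    then have c: "\<phi> c \<in> Lip_dom L\<^sub>B" "L\<^sub>B (\<phi> c) \<le> ennreal (Suc m)"
      and a: "\<phi> a \<in> Lip_dom L\<^sub>B" "L\<^sub>B (\<phi> a) \<le> ennreal (Suc m)"
      using K_dom by (auto simp: F_def)
    have "x = (1 / \<delta>) *\<^sub>R c + (- s) *\<^sub>R a"
      using \<delta> by (simp add: c_def s_def scaleR_add_right)
    then have "\<phi> x = (1 / \<delta>) *\<^sub>R \<phi> c + (- s) *\<^sub>R \<phi> a"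
      by (simp only: linear_add[OF lin] linear_scale[OF lin])
    also have "L\<^sub>B \<dots> \<le> ennreal (1 / \<delta>) * L\<^sub>B (\<phi> c) + ennreal s * L\<^sub>B (\<phi> a)"
      using Lip_add[OF B(1) subspace_scale[OF Lip_dom_subspace[OF B(1)] c(1)]
          subspace_scale[OF Lip_dom_subspace[OF B(1)] a(1)], of "1 / \<delta>" "- s"] \<delta> s
      by (simp only: Lip_scaleR[OF B(1)] c(1) a(1)) simp
    also have "\<dots> \<le> ennreal (1 / \<delta>) * ennreal (Suc m) + ennreal s * ennreal (Suc m)"
      by (intro add_mono mult_left_mono c a) auto
    also have "\<dots> = ennreal ((1 / \<delta> + s) * Suc m)"
      using \<delta> s by (simp add: distrib_right flip: ennreal_mult ennreal_plus)
    finally show ?thesis .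
  qed
  with \<delta> s show thesis
    by (intro that[of "(1 / \<delta> + s) * Suc m"]) (auto simp: K_def)
qed

theorem corollary2p3:
  fixes L\<^sub>A :: "'a::unital_cstar_algebra \<Rightarrow> ennreal"
    and L\<^sub>B :: "'b::unital_cstar_algebra \<Rightarrow> ennreal"
    and \<phi> :: "'a \<Rightarrow> 'b"
  assumes "quantum_compact_metric_space L\<^sub>A"
    and "quantum_compact_metric_space L\<^sub>B"
    and "lower_semicontinuous_Lip L\<^sub>A"
    and "lower_semicontinuous_Lip L\<^sub>B"
    and "unital_star_morphism \<phi>"
    and "\<phi> ` Lip_dom L\<^sub>A \<subseteq> Lip_dom L\<^sub>B"
  shows "\<exists>C>0. Lipschitz_morphism C L\<^sub>A L\<^sub>B \<phi>"
proof -
  note A = assms(1) and B = assms(2) and \<phi> = assms(5) and dom = assms(6)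
  note lin = morphism_linear[OF \<phi>]
  obtain D where D: "0 \<le> D" "\<And>a. a \<in> Lip_dom L\<^sub>A \<Longrightarrow> L\<^sub>A a \<le> 1 \<Longrightarrow> \<exists>t. norm (a - t *\<^sub>R 1) \<le> D"
    using Lip_ball_bounded_mod_const[OF A] by blast
  obtain M where M: "0 \<le> M"
    "\<And>a. a \<in> Lip_dom L\<^sub>A \<Longrightarrow> L\<^sub>A a \<le> 1 \<Longrightarrow> norm a \<le> D \<Longrightarrow> L\<^sub>B (\<phi> a) \<le> ennreal M"
    using Lip_bounded_on_ball[OF A assms(3) B assms(4) \<phi> dom D(1)] by blast
  \<comment> \<open>Translation by a constant moves \<open>a\<close> into the norm ball of radius
    \<open>D\<close>; neither Lip-norm notices, as \<phi> maps constants to constants.\<close>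
  have ball: "L\<^sub>B (\<phi> a) \<le> ennreal M" if a: "a \<in> Lip_dom L\<^sub>A" "L\<^sub>A a \<le> 1" for a
  proof -
    obtain t where t: "norm (a - t *\<^sub>R 1) \<le> D" using D(2)[OF a] by blast
    have c: "a + (- t) *\<^sub>R 1 \<in> Lip_dom L\<^sub>A" "L\<^sub>A (a + (- t) *\<^sub>R 1) \<le> 1"
      using subspace_add[OF Lip_dom_subspace[OF A] a(1) Lip_dom_const[OF A]]
        order_trans[OF Lip_add_const_le[OF A a(1)] a(2)] by blast+
    have "L\<^sub>B (\<phi> a) = L\<^sub>B (\<phi> (a + (- t) *\<^sub>R 1) + t *\<^sub>R 1)"
      by (simp add: linear_diff[OF lin] linear_scale[OF lin] morphism_one[OF \<phi>])
    also have "\<dots> \<le> L\<^sub>B (\<phi> (a + (- t) *\<^sub>R 1))"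
      using c(1) dom by (intro Lip_add_const_le[OF B]) blast
    also have "\<dots> \<le> ennreal M" using M(2)[OF c] t by simp
    finally show ?thesis .
  qed
  \<comment> \<open>\<open>M\<close> may be 0; with \<open>M + 1\<close> the constant is positive
    and its product with an infinite Lip-norm stays infinite.\<close>
  have "L\<^sub>B (\<phi> a) \<le> ennreal (M + 1) * L\<^sub>A a" if a: "a \<in> self_adjoint" for a
  proof (cases "L\<^sub>A a")
    case top
    then show ?thesis using M(1) by (simp add: ennreal_mult_top)
  next
    case (real r)
    with a have aL: "a \<in> Lip_dom L\<^sub>A" by (simp add: Lip_dom_def)
    show ?thesis
    proof (cases "r = 0")
      \<comment> \<open>No normalisation is possible here, but \<open>a\<close> is then a multiple
        of the unit and so is its image.\<close>
      case True
      then obtain t where "a = t *\<^sub>R 1"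
        using Lip_null[OF A] aL real by auto
      then show ?thesis
        by (simp add: linear_scale[OF lin] morphism_one[OF \<phi>] Lip_const[OF B])
    next
      case False
      define c where "c = (1 / r) *\<^sub>R a"
      have c: "c \<in> Lip_dom L\<^sub>A"
        unfolding c_def by (intro subspace_scale Lip_dom_subspace A aL)
      have "L\<^sub>A c \<le> 1"
        using False real by (simp add: c_def Lip_scaleR[OF A aL] flip: ennreal_mult)
      have "L\<^sub>B (\<phi> a) = L\<^sub>B (r *\<^sub>R \<phi> c)"
        using False by (simp add: c_def linear_scale[OF lin])
      also have "\<dots> = ennreal r * L\<^sub>B (\<phi> c)"
        using c dom real by (subst Lip_scaleR[OF B]) auto
      also have "\<dots> \<le> ennreal r * ennreal (M + 1)"
        using M(1) by (intro mult_left_mono order_trans[OF ball[OF c \<open>L\<^sub>A c \<le> 1\<close>]] ennreal_leI) auto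
      finally show ?thesis by (simp add: real mult.commute)
    qed
  qed
  with \<phi> M(1) show ?thesis
    unfolding Lipschitz_morphism_def by (intro exI[of _ "M + 1"]) auto
qed

end
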